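(* There is an infinite family $\mathcal{G}$ of connected split graphs such that every $G\in\mathcal{G}$ satisfies $\gamma_I^p(G)=|V(G)|$; in particular, the best constant $c$ such that $\gamma_I^p(G)\le c\,|V(G)|$ for all $G\in\mathcal{G}$ is $c=1$.
   Context: All graphs are finite, simple and undirected. A split graph is a graph whose vertex set can be partitioned into a clique and an independent set. For a graph $G=(V,E)$ and $v\in V$, $N(v)$ denotes the set of neighbours of $v$. A perfect Italian dominating function (PID-function) of $G$ is a function $f:V\to\{0,1,2\}$ such that for every vertex $v$ with $f(v)=0$ one has $\sum_{u\in N(v)} f(u)=2$. The weight of $f$ is $\sum_{v\in V} f(v)$. The perfect Italian domination number $\gamma_I^p(G)$ is the minimum weight of a PID-function of $G$. *)

theory Defs
  imports Complex_Main "Graph_Theory.Graph_Theory"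
begin

text \<open>
  A finite simple undirected graph is a \<^emph>\<open>pair_graph\<close>: a finite, loop-free, symmetric
  relation on a finite vertex set, so each edge occurs as two opposite arcs.
\<close>

definition neighbours :: "'a pair_pre_digraph \<Rightarrow> 'a \<Rightarrow> 'a set" where
  "neighbours G v = {u. (v, u) \<in> parcs G}"

definition is_clique :: "'a pair_pre_digraph \<Rightarrow> 'a set \<Rightarrow> bool" where
  "is_clique G K \<longleftrightarrow> K \<subseteq> pverts G \<and> (\<forall>u\<in>K. \<forall>v\<in>K. u \<noteq> v \<longrightarrow> (u, v) \<in> parcs G)"

definition is_independent :: "'a pair_pre_digraph \<Rightarrow> 'a set \<Rightarrow> bool" where
  "is_independent G I \<longleftrightarrow> I \<subseteq> pverts G \<and> (\<forall>u\<in>I. \<forall>v\<in>I. (u, v) \<notin> parcs G)"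

text \<open>Either part of the partition may be empty.\<close>

definition split_graph :: "'a pair_pre_digraph \<Rightarrow> bool" where
  "split_graph G \<longleftrightarrow> pair_graph G \<and>
     (\<exists>K I. K \<union> I = pverts G \<and> K \<inter> I = {} \<and> is_clique G K \<and> is_independent G I)"

text \<open>Values of \<open>f\<close> outside the vertex set are irrelevant, here and for the weight.\<close>

definition PID_function :: "'a pair_pre_digraph \<Rightarrow> ('a \<Rightarrow> nat) \<Rightarrow> bool" where
  "PID_function G f \<longleftrightarrow> f \<in> pverts G \<rightarrow> {0, 1, 2} \<and>
     (\<forall>v\<in>pverts G. f v = 0 \<longrightarrow> (\<Sum>u\<in>neighbours G v. f u) = 2)"

definition weight :: "'a pair_pre_digraph \<Rightarrow> ('a \<Rightarrow> nat) \<Rightarrow> nat" where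
  "weight G f = (\<Sum>v\<in>pverts G. f v)"

text \<open>The minimum is attained, since the constant function 1 is always a PID-function.\<close>

definition perfect_italian_domination_number :: "'a pair_pre_digraph \<Rightarrow> nat" where
  "perfect_italian_domination_number G = (LEAST w. \<exists>f. PID_function G f \<and> weight G f = w)"

lemma PID_function_const_1: "PID_function G (\<lambda>_. 1)"
  by (simp add: PID_function_def)

end

theory Submission
  imports Defs
begin

text \<open>
  Take a clique on \<open>k \<ge> 4\<close> vertices and, for each clique vertex \<open>j\<close>, one further vertex \<open>j'\<close> adjacent
  to all clique vertices except \<open>j\<close>. Let \<open>f\<close> be a PID-function and \<open>S\<close> its total on the clique. If
  \<open>f\<close> vanishes at a clique vertex \<open>v\<close>, then \<open>S \<le> 2\<close>. If \<open>S = 2\<close>, some clique vertex \<open>x \<noteq> v\<close> has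
  positive value, so \<open>x'\<close> sees less than 2 and is nonzero, but then \<open>v\<close> sees more than 2. If
  \<open>S < 2\<close>, all vertices \<open>j'\<close> are nonzero and \<open>v\<close> sees at least \<open>k - 1 \<ge> 3\<close>. Hence \<open>f\<close> is
  positive on the clique; every \<open>j'\<close> then sees at least \<open>k - 1 \<ge> 3\<close> and is nonzero as well. So
  \<open>f \<ge> 1\<close> everywhere, and the weight is at least the number of vertices.
\<close>

text \<open>The clique is \<open>{..<k}\<close>, and \<open>j + k\<close> plays the role of \<open>j'\<close>.\<close>

definition co_sun :: "nat \<Rightarrow> nat pair_pre_digraph" where
  "co_sun k = \<lparr>pverts = {..<2 * k},
     parcs = {(u, v). u < 2 * k \<and> v < 2 * k \<and> (u < k \<or> v < k) \<and> u mod k \<noteq> v mod k}\<rparr>"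

lemma pverts_co_sun [simp]: "pverts (co_sun k) = {..<2 * k}"
  by (simp add: co_sun_def)

lemma parcs_co_sun:
  "(u, v) \<in> parcs (co_sun k) \<longleftrightarrow>
     u < 2 * k \<and> v < 2 * k \<and> (u < k \<or> v < k) \<and> u mod k \<noteq> v mod k"
  by (simp add: co_sun_def)

lemma pair_graph_co_sun: "pair_graph (co_sun k)"
proof
  have "parcs (co_sun k) \<subseteq> {..<2 * k} \<times> {..<2 * k}"
    by (auto simp: parcs_co_sun)
  then show "finite (parcs (co_sun k))"
    by (rule finite_subset) simp
  show "symmetric (with_proj (co_sun k))"
    by (auto simp: symmetric_def parcs_co_sun intro!: symI)
qed (auto simp: parcs_co_sun)

lemma split_graph_co_sun: "split_graph (co_sun k)"
  unfolding split_graph_def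
proof (intro conjI exI)
  show "is_clique (co_sun k) {..<k}" "is_independent (co_sun k) {k..<2 * k}"
    by (auto simp: is_clique_def is_independent_def parcs_co_sun)
qed (auto simp: pair_graph_co_sun)

text \<open>Two residues cannot exhaust a clique of at least 3 vertices, so any two vertices have a
  common neighbour \<open>w\<close> in the clique.\<close>

lemma connected_co_sun:
  assumes "k \<ge> 3"
  shows "Digraph_Component.connected (with_proj (co_sun k))"
proof -
  interpret pair_graph "co_sun k"
    by (rule pair_graph_co_sun)
  have "u \<rightarrow>\<^sup>*\<^bsub>with_proj (co_sun k)\<^esub> v" if "u < 2 * k" "v < 2 * k" for u v
  proof -
    have "card {u mod k, v mod k} < card {..<k}"
      using card_insert_le_m1[of 2 "{v mod k}" "u mod k"] assms by simp
    then obtain w where w: "w < k" "w \<noteq> u mod k" "w \<noteq> v mod k"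
      using card_mono[of "{u mod k, v mod k}" "{..<k}"] by fastforce
    have "(u, w) \<in> parcs (co_sun k)" "(w, v) \<in> parcs (co_sun k)"
      using w that by (auto simp: parcs_co_sun)
    then show ?thesis
      by (meson reachable_adjI reachable_trans)
  qed
  then show ?thesis
    using assms sym_arcs
    by (auto simp: connected_def strongly_connected_def reachable_mk_symmetric_eq lessThan_empty_iff)
qed

lemma neighbours_co_sun_clique:
  assumes "v < k"
  shows "neighbours (co_sun k) v = ({..<k} - {v}) \<union> (\<lambda>j. j + k) ` ({..<k} - {v})"
proof -
  have "u \<in> (\<lambda>j. j + k) ` ({..<k} - {v})" if "u < 2 * k" "\<not> u < k" "u mod k \<noteq> v" for u
  proof -
    have "u - k < k" "u = (u - k) + k"
      using that by auto
    then have "u mod k = u - k"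
      by (metis mod_add_self2 mod_less)
    then show ?thesis
      using that \<open>u - k < k\<close> \<open>u = (u - k) + k\<close> by blast
  qed
  then show ?thesis
    using assms by (fastforce simp: neighbours_def parcs_co_sun)
qed

lemma neighbours_co_sun_independent:
  assumes "j < k"
  shows "neighbours (co_sun k) (j + k) = {..<k} - {j}"
  using assms by (auto simp: neighbours_def parcs_co_sun)

lemma PID_function_co_sun_pos:
  assumes "k \<ge> 4" "PID_function (co_sun k) f" "v < 2 * k"
  shows "f v \<ge> 1"
proof -
  define S where "S = sum f {..<k}"
  have S_remove: "S = f j + sum f ({..<k} - {j})" if "j < k" for j
    using that by (simp add: S_def sum.remove)
  have independent: "sum f ({..<k} - {j}) = 2" if "j < k" "f (j + k) = 0" for j
  proof -
    have "j + k \<in> pverts (co_sun k)"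
      using that by simp
    then have "sum f (neighbours (co_sun k) (j + k)) = 2"
      using assms(2) that(2) unfolding PID_function_def by blast
    then show ?thesis
      by (simp add: neighbours_co_sun_independent that(1))
  qed
  have clique: "f v \<ge> 1" if "v < k" for v
  proof (rule ccontr)
    assume "\<not> f v \<ge> 1"
    then have "f v = 0" by simp
    define T where "T = (\<Sum>j\<in>{..<k} - {v}. f (j + k))"
    have "sum f (neighbours (co_sun k) v) = 2"
      using assms(2) \<open>f v = 0\<close> that by (auto simp: PID_function_def)
    moreover have "sum f (neighbours (co_sun k) v) =
        sum f ({..<k} - {v}) + sum f ((\<lambda>j. j + k) ` ({..<k} - {v}))"
      unfolding neighbours_co_sun_clique[OF that] by (rule sum.union_disjoint) auto
    moreover have "sum f ((\<lambda>j. j + k) ` ({..<k} - {v})) = T"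
      by (simp add: T_def sum.reindex)
    \<comment> \<open>Since \<open>f v = 0\<close>, removing \<open>v\<close> from the clique does
      not change \<open>S\<close>.\<close>
    ultimately have ST: "S + T = 2"
      using S_remove[OF that] \<open>f v = 0\<close> by simp
    have "S < 2"
    proof (rule ccontr)
      assume "\<not> S < 2"
      then have "S \<noteq> 0" by simp
      then obtain x where x: "x < k" "f x \<noteq> 0"
        by (auto simp: S_def)
      \<comment> \<open>Otherwise the clique without \<open>x\<close> already sums to 2, and
        \<open>f x > 0\<close> pushes \<open>S\<close> above 2. As \<open>f v = 0\<close>,
        \<open>x\<close> differs from \<open>v\<close>, so \<open>f (x + k)\<close> is a term of
        \<open>T\<close>.\<close>
      have "f (x + k) \<noteq> 0"
        using independent[of x] S_remove[of x] x ST by auto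
      moreover have "f (x + k) \<le> T"
        unfolding T_def using x \<open>f v = 0\<close> by (intro member_le_sum) auto
      ultimately show False
        using ST \<open>\<not> S < 2\<close> by simp
    qed
    then have "f (j + k) \<ge> 1" if "j < k" for j
      using independent[of j] S_remove[of j] that by fastforce
    \<comment> \<open>The left side is \<open>k - 1\<close>, at least 3, whereas \<open>T\<close> is
      at most 2.\<close>
    then have "(\<Sum>j\<in>{..<k} - {v}. 1) \<le> T"
      unfolding T_def by (intro sum_mono) auto
    then show False
      using ST that assms(1) by simp
  qed
  show ?thesis
  proof (cases "v < k")
    case True
    then show ?thesis by (rule clique)
  next
    case False
    define j where "j = v - k"
    have j: "j < k" "v = j + k"
      using False assms(3) by (auto simp: j_def)
    have "(\<Sum>i\<in>{..<k} - {j}. 1) \<le> sum f ({..<k} - {j})"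
      using clique by (intro sum_mono) auto
    then have "sum f ({..<k} - {j}) \<ge> 3"
      using j(1) assms(1) by simp
    then show ?thesis
      using independent[OF j(1)] j(2) by fastforce
  qed
qed

lemma perfect_italian_domination_number_co_sun:
  assumes "k \<ge> 4"
  shows "perfect_italian_domination_number (co_sun k) = 2 * k"
  unfolding perfect_italian_domination_number_def
proof (rule Least_equality)
  show "\<exists>f. PID_function (co_sun k) f \<and> weight (co_sun k) f = 2 * k"
    using PID_function_const_1 by (intro exI[of _ "\<lambda>_. 1"]) (auto simp: weight_def)
next
  fix w
  assume "\<exists>f. PID_function (co_sun k) f \<and> weight (co_sun k) f = w"
  then obtain f where f: "PID_function (co_sun k) f" "weight (co_sun k) f = w"
    by blast
  have "(\<Sum>v<2 * k. 1) \<le> sum f {..<2 * k}"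
    using PID_function_co_sun_pos[OF assms f(1)] by (intro sum_mono) auto
  then show "2 * k \<le> w"
    using f(2) by (simp add: weight_def)
qed

text \<open>Distinct members of the family have different orders \<open>2 * k\<close>, so this
  invariant makes them pairwise non-isomorphic.\<close>

lemma digraph_iso_card_verts:
  assumes "digraph_iso G H"
  shows "card (verts G) = card (verts H)"
  using assms
  by (auto simp: digraph_iso_def verts_app_iso pre_digraph.digraph_isomorphism_def card_image)

theorem theorem34:
  shows "\<exists>\<G> :: nat pair_pre_digraph set.
    infinite \<G> \<and>
    (\<forall>G\<in>\<G>. \<forall>H\<in>\<G>. G \<noteq> H \<longrightarrow> \<not> digraph_iso (with_proj G) (with_proj H)) \<and>
    (\<forall>G\<in>\<G>. split_graph G \<and> Digraph_Component.connected (with_proj G)) \<and>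
    (\<forall>G\<in>\<G>. perfect_italian_domination_number G = card (pverts G)) \<and>
    (\<forall>G\<in>\<G>. real (perfect_italian_domination_number G) \<le> 1 * real (card (pverts G))) \<and>
    (\<forall>c :: real.
       (\<forall>G\<in>\<G>. real (perfect_italian_domination_number G) \<le> c * real (card (pverts G)))
         \<longrightarrow> 1 \<le> c)"
proof (intro exI[of _ "co_sun ` {4..}"] conjI ballI impI allI)
  have "inj co_sun"
    by (rule injI) (metis card_lessThan mult_cancel1 pverts_co_sun zero_neq_numeral)
  then show "infinite (co_sun ` {4..})"
    by (metis finite_imageD infinite_Ici inj_on_subset subset_UNIV)
next
  fix G H
  assume "G \<in> co_sun ` {4..}" "H \<in> co_sun ` {4..}" "G \<noteq> H"
  then show "\<not> digraph_iso (with_proj G) (with_proj H)"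
    by (auto dest!: digraph_iso_card_verts)
next
  fix c :: real
  assume "\<forall>G\<in>co_sun ` {4..}.
    real (perfect_italian_domination_number G) \<le> c * real (card (pverts G))"
  \<comment> \<open>One member suffices, since the ratio is exactly 1: here 8 \<le> 8c.\<close>
  then have "real (perfect_italian_domination_number (co_sun 4)) \<le>
      c * real (card (pverts (co_sun 4)))"
    by blast
  then show "1 \<le> c"
    by (simp add: perfect_italian_domination_number_co_sun)
qed (auto simp: split_graph_co_sun connected_co_sun perfect_italian_domination_number_co_sun)

end
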